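(* For each diameter diminishing to zero iterated function system $\mathcal{S}=((X,d),(f_i)_{i\in I})$, the associated function $\pi:\Lambda(I)\to X$, $\pi(\omega)=a_\omega$, is continuous.
   Context: Metric spaces are nonempty. For a metric space $(X,d)$, $P_b(X)$ is the set of nonempty bounded subsets of $X$ and $P_{b,cl}(X)$ the set of nonempty bounded closed subsets. An iterated function system (IFS) is a pair $\mathcal{S}=((X,d),(f_i)_{i\in I})$ where $(X,d)$ is a complete metric space, $I$ is a nonempty finite set, each $f_i:X\to X$ is continuous, and $f_i(B)\in P_b(X)$ for every $B\in P_b(X)$ and $i\in I$. Its fractal operator $F_{\mathcal{S}}:P_{b,cl}(X)\to P_{b,cl}(X)$ is $F_{\mathcal{S}}(B)=\overline{\bigcup_{i\in I}f_i(B)}$. $\mathbb{N}^*=\{1,2,\dots\}$. $\Lambda(I)=I^{\mathbb{N}^*}$ is the set of infinite words $\omega=\omega_1\omega_2\dots$ over $I$, with the metric $d_\Lambda(\omega,\theta)=0$ if $\omega=\theta$ and $d_\Lambda(\omega,\theta)=2^{-\min\{k\in\mathbb{N}^*\mid\omega_k\neq\theta_k\}}$ otherwise. $\Lambda_n(I)$ is the set of words of length $n$ over $I$; $[\omega]_n=\omega_1\dots\omega_n$ for $\omega\in\Lambda(I)$; $f_\omega=f_{\omega_1}\circ\dots\circ f_{\omega_n}$ for $\omega=\omega_1\dots\omega_n\in\Lambda_n(I)$. An IFS $\mathcal{S}$ is diameter diminishing to zero if for every $B\in P_{b,cl}(X)$ there exists $M_B\in P_{b,cl}(X)$ such that $B\subseteq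 M_B$, $F_{\mathcal{S}}(M_B)\subseteq M_B$ and $\lim_{n\to\infty}\max_{\omega\in\Lambda_n(I)}\mathrm{diam}(f_\omega(M_B))=0$. For a diameter diminishing to zero IFS and $\omega\in\Lambda(I)$, $a_\omega\in X$ denotes the unique point (it exists) such that $\bigcap_{n\in\mathbb{N}^*}\overline{f_{[\omega]_n}(B)}=\{a_\omega\}$ for every $B\in P_{b,cl}(X)$ with $F_{\mathcal{S}}(B)\subseteq B$; and $\pi:\Lambda(I)\to X$ is defined by $\pi(\omega)=a_\omega$. *)

theory Defs
  imports "HOL-Analysis.Analysis" "HOL-Library.Stream"
begin

section \<open>Iterated function systems\<close>

definition P_b :: "'a::metric_space set set" where
  "P_b = {B. B \<noteq> {} \<and> bounded B}"

definition P_bcl :: "'a::metric_space set set" where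
  "P_bcl = {B. B \<noteq> {} \<and> bounded B \<and> closed B}"

text \<open>The space $X$ is the whole (automatically nonempty) type \<^typ>\<open>'a\<close>, whose class
  \<^class>\<open>complete_space\<close> provides the complete metric; only the maps
  \<open>f i\<close> with \<open>i \<in> I\<close> belong to the system.\<close>

definition IFS :: "'i set \<Rightarrow> ('i \<Rightarrow> 'a::complete_space \<Rightarrow> 'a) \<Rightarrow> bool" where
  "IFS I f \<longleftrightarrow> finite I \<and> I \<noteq> {} \<and>
     (\<forall>i\<in>I. continuous_on UNIV (f i)) \<and>
     (\<forall>i\<in>I. \<forall>B\<in>P_b. f i ` B \<in> P_b)"

definition fractal_op :: "'i set \<Rightarrow> ('i \<Rightarrow> 'a::complete_space \<Rightarrow> 'a) \<Rightarrow> 'a set \<Rightarrow> 'a set" where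
  "fractal_op I f B = closure (\<Union>i\<in>I. f i ` B)"


section \<open>Words\<close>

text \<open>Infinite words over $I$ are the elements of \<^term>\<open>streams I\<close>. Stream positions start at
  $0$, so the letter $\omega_k$ ($k \ge 1$) is \<open>\<omega> !! (k - 1)\<close>; this accounts for the \<^const>\<open>Suc\<close>
  in the metric. The prefix $[\omega]_n$ is \<open>stake n \<omega>\<close>.\<close>

definition word_dist :: "'i stream \<Rightarrow> 'i stream \<Rightarrow> real" where
  "word_dist \<omega> \<theta> =
     (if \<omega> = \<theta> then 0 else (1/2) ^ Suc (LEAST k. \<omega> !! k \<noteq> \<theta> !! k))"

definition words :: "'i set \<Rightarrow> nat \<Rightarrow> 'i list set" where
  "words I n = {w. set w \<subseteq> I \<and> length w = n}"

primrec word_map :: "('i \<Rightarrow> 'a \<Rightarrow> 'a) \<Rightarrow> 'i list \<Rightarrow> 'a \<Rightarrow> 'a" where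
  "word_map f [] = id"
| "word_map f (i # w) = f i \<circ> word_map f w"

lemma Metric_space_word_dist: "Metric_space (streams I) word_dist"
proof
  fix \<omega> \<theta> :: "'i stream"
  show "0 \<le> word_dist \<omega> \<theta>" by (simp add: word_dist_def)
  show "word_dist \<omega> \<theta> = word_dist \<theta> \<omega>" by (simp add: word_dist_def eq_commute)
  show "word_dist \<omega> \<theta> = 0 \<longleftrightarrow> \<omega> = \<theta>" by (simp add: word_dist_def)
next
  fix \<omega> \<theta> \<eta> :: "'i stream"
  show "word_dist \<omega> \<eta> \<le> word_dist \<omega> \<theta> + word_dist \<theta> \<eta>"
  proof (cases "\<omega> = \<eta> \<or> \<omega> = \<theta> \<or> \<theta> = \<eta>")
    case True
    then show ?thesis by (auto simp: word_dist_def)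
  next
    case False
    define m where "m = (LEAST k. \<omega> !! k \<noteq> \<eta> !! k)"
    define p where "p = (LEAST k. \<omega> !! k \<noteq> \<theta> !! k)"
    define q where "q = (LEAST k. \<theta> !! k \<noteq> \<eta> !! k)"
    have "\<exists>k. \<omega> !! k \<noteq> \<eta> !! k"
      using False by (metis stream_smap_nats smap_alt)
    then have "\<omega> !! m \<noteq> \<eta> !! m" unfolding m_def by (rule LeastI_ex)
    then have "\<omega> !! m \<noteq> \<theta> !! m \<or> \<theta> !! m \<noteq> \<eta> !! m" by auto
    then have "p \<le> m \<or> q \<le> m" unfolding p_def q_def by (auto intro: Least_le)
    then have "(1/2::real) ^ Suc m \<le> (1/2) ^ Suc p \<or> (1/2::real) ^ Suc m \<le> (1/2) ^ Suc q"
      by (auto intro!: power_decreasing)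
    moreover have "0 \<le> (1/2::real) ^ Suc p" "0 \<le> (1/2::real) ^ Suc q" by simp_all
    ultimately have "(1/2::real) ^ Suc m \<le> (1/2) ^ Suc p + (1/2) ^ Suc q" by linarith
    then show ?thesis using False by (simp add: word_dist_def m_def p_def q_def)
  qed
qed


section \<open>Diameter diminishing to zero systems\<close>

definition diam_diminishing :: "'i set \<Rightarrow> ('i \<Rightarrow> 'a::complete_space \<Rightarrow> 'a) \<Rightarrow> bool" where
  "diam_diminishing I f \<longleftrightarrow>
     (\<forall>B\<in>P_bcl. \<exists>M\<in>P_bcl. B \<subseteq> M \<and> fractal_op I f M \<subseteq> M \<and>
        (\<lambda>n. Max ((\<lambda>w. diameter (word_map f w ` M)) ` words I n)) \<longlonglongrightarrow> 0)"

text \<open>The value $a_\omega$ of the canonical projection $\pi$. The description is meaningful for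
  diameter diminishing to zero systems, where exactly one such point exists.\<close>

definition code_map :: "'i set \<Rightarrow> ('i \<Rightarrow> 'a::complete_space \<Rightarrow> 'a) \<Rightarrow> 'i stream \<Rightarrow> 'a" where
  "code_map I f \<omega> =
     (THE a. \<forall>B\<in>P_bcl. fractal_op I f B \<subseteq> B \<longrightarrow>
        (\<Inter>n\<in>{1..}. closure (word_map f (stake n \<omega>) ` B)) = {a})"

end

theory Submission
  imports Defs
begin

text \<open>
  Continuity of the coding map holds because points with a long common prefix \<open>w\<close> both lie in
  the single set \<open>closure (word_map f w ` M)\<close>, where \<open>M\<close> is one fixed forward invariant bounded
  set whose images shrink. The maximum over all words of length \<open>n\<close> in the shrinking condition
  bounds the diameter of this set uniformly in \<open>w\<close> (\<open>shrinking_dist_less\<close>), and a small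
  \<^const>\<open>word_dist\<close> forces a long common prefix (\<open>stake_eq_if_word_dist_less\<close>). So the coding map
  is even uniformly continuous.

  This presupposes that the description operator in \<^const>\<open>code_map\<close> denotes the intended point.
  For an invariant \<open>B\<close> contained in a shrinking set, the closed sets
  \<open>closure (word_map f (stake n \<omega>) ` B)\<close> are nested with diameters tending to zero, and
  Cantor's intersection theorem yields exactly one common point (\<open>Inter_prefix_sets_singleton\<close>).
  Two invariant sets give the same point, since their union lies in a shrinking set \<open>M\<close>
  and each of the two points is a common point of the nest built from \<open>M\<close>
  (\<open>Inter_prefix_sets_eq_code_map\<close>).
\<close>

definition shrinking :: "'i set \<Rightarrow> ('i \<Rightarrow> 'a::complete_space \<Rightarrow> 'a) \<Rightarrow> 'a set \<Rightarrow> bool" where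
  "shrinking I f M \<longleftrightarrow> M \<in> P_bcl \<and> fractal_op I f M \<subseteq> M \<and>
     (\<lambda>n. Max ((\<lambda>w. diameter (word_map f w ` M)) ` words I n)) \<longlonglongrightarrow> 0"

lemma diam_diminishing_obtains_shrinking:
  assumes "diam_diminishing I f" and "B \<in> P_bcl"
  obtains M where "shrinking I f M" and "B \<subseteq> M"
  using assms unfolding diam_diminishing_def shrinking_def by blast

lemma word_map_append: "word_map f (v @ w) = word_map f v \<circ> word_map f w"
  by (induction v) auto

lemma image_subset_if_fractal_op_subset:
  assumes "fractal_op I f B \<subseteq> B" and "i \<in> I"
  shows "f i ` B \<subseteq> B"
proof -
  have "f i ` B \<subseteq> (\<Union>i\<in>I. f i ` B)"
    using assms(2) by blast
  also have "\<dots> \<subseteq> fractal_op I f B"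
    unfolding fractal_op_def by (rule closure_subset)
  finally show ?thesis
    using assms(1) by blast
qed

lemma word_map_image_subset:
  assumes "fractal_op I f B \<subseteq> B" and "set w \<subseteq> I"
  shows "word_map f w ` B \<subseteq> B"
  using assms(2)
proof (induction w)
  case (Cons i w)
  then show ?case
    using image_subset_if_fractal_op_subset[OF assms(1), of i] by fastforce
qed simp

lemma stake_in_words:
  assumes "\<omega> \<in> streams I"
  shows "stake n \<omega> \<in> words I n"
  using assms unfolding words_def by (auto simp: in_set_conv_nth snth_in)

lemma finite_words: "finite I \<Longrightarrow> finite (words I n)"
  unfolding words_def by (rule finite_lists_length_eq)

text \<open>Applying one more letter first maps \<open>B\<close> into itself, so that a longer prefix has the
  smaller image.\<close>

lemma prefix_sets_decreasing:
  assumes "fractal_op I f B \<subseteq> B" and "\<omega> \<in> streams I" and "m \<le> n"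
  shows "closure (word_map f (stake n \<omega>) ` B) \<subseteq> closure (word_map f (stake m \<omega>) ` B)"
  using assms(3)
proof (induction rule: dec_induct)
  case (step n)
  have "f (\<omega> !! n) ` B \<subseteq> B"
    using assms by (intro image_subset_if_fractal_op_subset) (auto simp: snth_in)
  then have "word_map f (stake (Suc n) \<omega>) ` B \<subseteq> word_map f (stake n \<omega>) ` B"
    unfolding stake_Suc word_map_append by auto
  then show ?case
    using step.IH closure_mono by blast
qed simp

text \<open>The bound is uniform over all words of the same length, which is what gives continuity.\<close>

lemma shrinking_dist_less:
  assumes "finite I" and "shrinking I f M" and "\<epsilon> > 0"
  obtains n where "\<And>w x y. \<lbrakk>w \<in> words I n; x \<in> closure (word_map f w ` M);
    y \<in> closure (word_map f w ` M)\<rbrakk> \<Longrightarrow> dist x y < \<epsilon>"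
proof -
  have inv: "fractal_op I f M \<subseteq> M" and "bounded M"
    using assms(2) unfolding shrinking_def P_bcl_def by auto
  have "(\<lambda>n. Max ((\<lambda>w. diameter (word_map f w ` M)) ` words I n)) \<longlonglongrightarrow> 0"
    using assms(2) unfolding shrinking_def by blast
  then have "\<forall>\<^sub>F n in sequentially. Max ((\<lambda>w. diameter (word_map f w ` M)) ` words I n) < \<epsilon>"
    using assms(3) by (rule order_tendstoD)
  then obtain n where n: "Max ((\<lambda>w. diameter (word_map f w ` M)) ` words I n) < \<epsilon>"
    by (meson eventually_happens' sequentially_bot)
  show ?thesis
  proof
    fix w x y
    assume w: "w \<in> words I n"
      and xy: "x \<in> closure (word_map f w ` M)" "y \<in> closure (word_map f w ` M)"
    have "word_map f w ` M \<subseteq> M"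
      using w inv by (intro word_map_image_subset) (auto simp: words_def)
    then have bdd: "bounded (word_map f w ` M)"
      using \<open>bounded M\<close> bounded_subset by blast
    then have "dist x y \<le> diameter (closure (word_map f w ` M))"
      using xy by (intro diameter_bounded_bound) auto
    also have "\<dots> = diameter (word_map f w ` M)"
      using bdd by (rule diameter_closure)
    also have "\<dots> \<le> Max ((\<lambda>w. diameter (word_map f w ` M)) ` words I n)"
      using w finite_words[OF assms(1)] by (intro Max_ge) auto
    finally show "dist x y < \<epsilon>"
      using n by linarith
  qed
qed

lemma Inter_prefix_sets_singleton:
  assumes "finite I" and "shrinking I f M" and "\<omega> \<in> streams I"
    and "B \<in> P_bcl" and "fractal_op I f B \<subseteq> B" and "B \<subseteq> M"
  shows "\<exists>a. (\<Inter>n\<in>{1..}. closure (word_map f (stake n \<omega>) ` B)) = {a}"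
proof -
  define S where "S n = closure (word_map f (stake (Suc n) \<omega>) ` B)" for n
  have "\<exists>a. \<Inter>(range S) = {a}"
  proof (rule decreasing_closed_nest_sing)
    show "closed (S n)" "S n \<noteq> {}" for n
      using assms(4) unfolding S_def P_bcl_def by auto
    show "S n \<subseteq> S m" if "m \<le> n" for m n
      unfolding S_def using that by (intro prefix_sets_decreasing[OF assms(5,3)]) simp
    fix \<epsilon> :: real
    assume "\<epsilon> > 0"
    then obtain n where n: "\<And>w x y. \<lbrakk>w \<in> words I n; x \<in> closure (word_map f w ` M);
        y \<in> closure (word_map f w ` M)\<rbrakk> \<Longrightarrow> dist x y < \<epsilon>"
      using shrinking_dist_less assms(1,2) by blast
    have "S n \<subseteq> closure (word_map f (stake n \<omega>) ` B)"
      unfolding S_def by (intro prefix_sets_decreasing[OF assms(5,3)]) simp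
    also have "\<dots> \<subseteq> closure (word_map f (stake n \<omega>) ` M)"
      using assms(6) by (intro closure_mono image_mono)
    finally show "\<exists>n. \<forall>x\<in>S n. \<forall>y\<in>S n. dist x y < \<epsilon>"
      using n[OF stake_in_words[OF assms(3)]] by blast
  qed
  moreover have "{1..} = range Suc"
    by (auto simp: image_iff Suc_le_eq gr0_conv_Suc)
  then have "(\<Inter>n\<in>{1..}. closure (word_map f (stake n \<omega>) ` B)) = \<Inter>(range S)"
    unfolding S_def by (simp only: image_image)
  ultimately show ?thesis
    by simp
qed

lemma Inter_prefix_sets_eq_code_map:
  assumes "finite I" and "diam_diminishing I f" and "\<omega> \<in> streams I"
    and "B \<in> P_bcl" and "fractal_op I f B \<subseteq> B"
  shows "(\<Inter>n\<in>{1..}. closure (word_map f (stake n \<omega>) ` B)) = {code_map I f \<omega>}"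
proof -
  let ?J = "\<lambda>B. \<Inter>n\<in>{1..}. closure (word_map f (stake n \<omega>) ` B)"
  let ?inv = "\<lambda>B. B \<in> P_bcl \<and> fractal_op I f B \<subseteq> B"
  have mono: "?J C \<subseteq> ?J D" if "C \<subseteq> D" for C D
    using that by (intro INT_anti_mono order_refl closure_mono image_mono)
  have sing: "\<exists>a. ?J C = {a}" if "?inv C" "C \<subseteq> M" "shrinking I f M" for C M
    using Inter_prefix_sets_singleton[OF assms(1) that(3) assms(3)] that by blast
  obtain a where a: "?J B = {a}"
    using assms sing diam_diminishing_obtains_shrinking by metis
  have all: "?J C = {a}" if C: "?inv C" for C
  proof -
    have "B \<union> C \<in> P_bcl"
      using C assms(4) unfolding P_bcl_def by auto
    then obtain M where M: "shrinking I f M" "B \<union> C \<subseteq> M"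
      using diam_diminishing_obtains_shrinking assms(2) by blast
    then have "?inv M"
      unfolding shrinking_def by blast
    obtain b c where "?J C = {b}" "?J M = {c}"
      using sing[OF C _ M(1)] sing[OF \<open>?inv M\<close> order_refl M(1)] M(2) by blast
    then show ?thesis
      using a mono[of B M] mono[of C M] M(2) by auto
  qed
  have "code_map I f \<omega> = a"
    unfolding code_map_def
  proof (rule the_equality)
    show "\<forall>C\<in>P_bcl. fractal_op I f C \<subseteq> C \<longrightarrow> ?J C = {a}"
      using all by blast
  next
    fix b
    assume "\<forall>C\<in>P_bcl. fractal_op I f C \<subseteq> C \<longrightarrow> ?J C = {b}"
    then have "?J B = {b}"
      using assms(4,5) by blast
    then show "b = a"
      using a by simp
  qed
  then show ?thesis
    using a by simp
qed

lemma code_map_in_prefix_set: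
  assumes "finite I" and "diam_diminishing I f" and "\<omega> \<in> streams I" and "shrinking I f M"
  shows "code_map I f \<omega> \<in> closure (word_map f (stake n \<omega>) ` M)"
proof -
  have M: "M \<in> P_bcl" "fractal_op I f M \<subseteq> M"
    using assms(4) unfolding shrinking_def by auto
  have "code_map I f \<omega> \<in> closure (word_map f (stake (Suc n) \<omega>) ` M)"
    using Inter_prefix_sets_eq_code_map[OF assms(1-3) M] by fastforce
  then show ?thesis
    using prefix_sets_decreasing[OF M(2) assms(3), of n "Suc n"] by (auto simp del: stake.simps)
qed

lemma stake_eq_if_word_dist_less:
  assumes "word_dist \<omega> \<theta> < (1/2) ^ n"
  shows "stake n \<omega> = stake n \<theta>"
proof (cases "\<omega> = \<theta>")
  case False
  define k where "k = (LEAST k. \<omega> !! k \<noteq> \<theta> !! k)"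
  have "(1/2::real) ^ Suc k < (1/2) ^ n"
    using assms False by (simp add: word_dist_def k_def)
  then have "n < Suc k"
    by (subst (asm) power_strict_decreasing_iff) auto
  then have "\<omega> !! m = \<theta> !! m" if "m < n" for m
    using that not_less_Least[of m "\<lambda>k. \<omega> !! k \<noteq> \<theta> !! k"] unfolding k_def by auto
  then show ?thesis
    by (intro nth_equalityI) auto
qed simp

theorem proposition3p4:
  fixes I :: "'i set" and f :: "'i \<Rightarrow> 'a::complete_space \<Rightarrow> 'a"
  assumes "IFS I f" and "diam_diminishing I f"
  shows "continuous_map (Metric_space.mtopology (streams I) word_dist) euclidean (code_map I f)"
proof -
  interpret Metric_space "streams I" word_dist
    by (rule Metric_space_word_dist)
  have fin: "finite I"
    using assms(1) unfolding IFS_def by blast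
  (* A point is only a seed: any nonempty bounded closed set lies in some shrinking set. *)
  have "{undefined} \<in> (P_bcl :: 'a set set)"
    unfolding P_bcl_def by simp
  then obtain M where M: "shrinking I f M"
    using diam_diminishing_obtains_shrinking assms(2) by blast
  have "continuous_map mtopology Met_TC.mtopology (code_map I f)"
    unfolding metric_continuous_map[OF Met_TC.Metric_space_axioms]
  proof (intro conjI ballI allI impI)
    fix \<omega> and \<epsilon> :: real
    assume \<omega>: "\<omega> \<in> streams I" and "\<epsilon> > 0"
    then obtain n where n: "\<And>w x y. \<lbrakk>w \<in> words I n; x \<in> closure (word_map f w ` M);
        y \<in> closure (word_map f w ` M)\<rbrakk> \<Longrightarrow> dist x y < \<epsilon>"
      using shrinking_dist_less[OF fin M] by blast
    have "dist (code_map I f \<omega>) (code_map I f \<theta>) < \<epsilon>"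
      if \<theta>: "\<theta> \<in> streams I" and "word_dist \<omega> \<theta> < (1/2) ^ n" for \<theta>
    proof (rule n)
      show "stake n \<omega> \<in> words I n"
        using \<omega> by (rule stake_in_words)
      show "code_map I f \<omega> \<in> closure (word_map f (stake n \<omega>) ` M)"
        using fin assms(2) \<omega> M by (rule code_map_in_prefix_set)
      show "code_map I f \<theta> \<in> closure (word_map f (stake n \<omega>) ` M)"
        using code_map_in_prefix_set[OF fin assms(2) \<theta> M]
          stake_eq_if_word_dist_less[OF that(2)] by simp
    qed
    then show "\<exists>\<delta>>0. \<forall>\<theta>. \<theta> \<in> streams I \<and> word_dist \<omega> \<theta> < \<delta> \<longrightarrow>
        dist (code_map I f \<omega>) (code_map I f \<theta>) < \<epsilon>"
      by (intro exI[of _ "(1/2) ^ n"]) auto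
  qed simp
  then show ?thesis
    by simp
qed

end
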